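(* Let $\Gamma\curvearrowright X, I$ be a dynamical ideal with permutation model $W[[X]]$. (1) If $W[[X]]$ fails the axiom of dependent choices, then Player I has a winning strategy in the DC game. (2) If $X$ is a Polish space and $I$ is generated (as an ideal, i.e. $I$ consists of all subsets of sets in the family) by an analytic family of closed subsets of $X$ (analytic in the Effros Borel space / hyperspace of closed sets), then the DC game is determined.
   Context: Work in ZFC. $V[[X]]$ is the well-founded model of ZFCA with set of atoms exactly $X$ in which every set of elements is represented by an element; a group action of $\Gamma$ on $X$ extends to $V[[X]]$ by $\gamma\cdot A=\{\gamma\cdot B:B\in A\}$. $\mathrm{stab}(A)=\{\gamma:\gamma\cdot A=A\}$, $\mathrm{pstab}(a)=\{\gamma:\gamma\cdot B=B\ \forall B\in a\}$. A dynamical ideal $\Gamma\curvearrowright X, I$: a group $\Gamma$ acting on $X$ and a $\Gamma$-invariant ideal $I$ on $X$ containing all singletons. Its permutation model $W[[X]]$ is the class of $A\in V[[X]]$ such that $A$ and every element of its transitive closure are symmetric, where $A$ is symmetric if $\mathrm{pstab}(b)\subseteq\mathrm{stab}(A)$ for some $b\in I$. The axiom of dependent choices (DC): every partial order has either a minimal element or an infinite strictly descending sequence. The DC game: players I and II alternate for $\omega$ rounds; at round $n$ Player I plays $a_n\in I$ and Player II answers with $\gamma_n\in\Gamma$, subject to the rules $\gamma_0=1$ and $\gamma_n$ fixes every element of $\bigcup_{m<n}\gamma_m\cdot a_m$. Player II wins if $\bigcup_{n\in\omega}\gamma_n\cdot a_n\in I$; otherwise Player I wins. The game is determined if one of the players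 has a winning strategy. *)

theory Defs
  imports "HOL-Analysis.Analysis" "HOL-Algebra.Group_Action"
begin

definition dynamical_ideal ::
  "('g, 'b) monoid_scheme \<Rightarrow> ('g \<Rightarrow> 'x \<Rightarrow> 'x) \<Rightarrow> 'x set \<Rightarrow> 'x set set \<Rightarrow> bool" where
  "dynamical_ideal G \<phi> X I \<longleftrightarrow>
     group_action G X \<phi> \<and>
     I \<subseteq> Pow X \<and> {} \<in> I \<and>
     (\<forall>A\<in>I. \<forall>B. B \<subseteq> A \<longrightarrow> B \<in> I) \<and>
     (\<forall>A\<in>I. \<forall>B\<in>I. A \<union> B \<in> I) \<and>
     (\<forall>x\<in>X. {x} \<in> I) \<and>
     (\<forall>g\<in>carrier G. \<forall>A\<in>I. \<phi> g ` A \<in> I)"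

definition pstab :: "('g, 'b) monoid_scheme \<Rightarrow> ('g \<Rightarrow> 'x \<Rightarrow> 'x) \<Rightarrow> 'x set \<Rightarrow> 'g set" where
  "pstab G \<phi> a = {g \<in> carrier G. \<forall>x\<in>a. \<phi> g x = x}"

text \<open>A run of the game: I plays a n, II plays g n. The run obeys the rules iff
  g 0 = 1 and g n fixes every element of the union of g m applied to a m, m < n.\<close>
definition legal_run ::
  "('g, 'b) monoid_scheme \<Rightarrow> ('g \<Rightarrow> 'x \<Rightarrow> 'x) \<Rightarrow> (nat \<Rightarrow> 'x set) \<Rightarrow> (nat \<Rightarrow> 'g) \<Rightarrow> bool" where
  "legal_run G \<phi> a g \<longleftrightarrow>
     (\<forall>n. g n \<in> carrier G) \<and> g 0 = \<one>\<^bsub>G\<^esub> \<and>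
     (\<forall>n. \<forall>x \<in> (\<Union>m<n. \<phi> (g m) ` a m). \<phi> (g n) x = x)"

definition run_union :: "('g \<Rightarrow> 'x \<Rightarrow> 'x) \<Rightarrow> (nat \<Rightarrow> 'x set) \<Rightarrow> (nat \<Rightarrow> 'g) \<Rightarrow> 'x set" where
  "run_union \<phi> a g = (\<Union>n. \<phi> (g n) ` a n)"

text \<open>A strategy for Player I maps the list of II's previous moves to I's next move
  (I's own previous moves are determined by the strategy).\<close>
definition I_wins ::
  "('g, 'b) monoid_scheme \<Rightarrow> ('g \<Rightarrow> 'x \<Rightarrow> 'x) \<Rightarrow> 'x set set \<Rightarrow> bool" where
  "I_wins G \<phi> I \<longleftrightarrow>
     (\<exists>\<sigma> :: 'g list \<Rightarrow> 'x set. (\<forall>h. \<sigma> h \<in> I) \<and>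
        (\<forall>g. legal_run G \<phi> (\<lambda>n. \<sigma> (map g [0..<n])) g \<longrightarrow>
             run_union \<phi> (\<lambda>n. \<sigma> (map g [0..<n])) g \<notin> I))"

definition II_wins ::
  "('g, 'b) monoid_scheme \<Rightarrow> ('g \<Rightarrow> 'x \<Rightarrow> 'x) \<Rightarrow> 'x set set \<Rightarrow> bool" where
  "II_wins G \<phi> I \<longleftrightarrow>
     (\<exists>\<tau> :: 'x set list \<Rightarrow> 'g.
        \<forall>a. (\<forall>n. a n \<in> I) \<longrightarrow>
            legal_run G \<phi> a (\<lambda>n. \<tau> (map a [0..<Suc n])) \<and>
            run_union \<phi> a (\<lambda>n. \<tau> (map a [0..<Suc n])) \<in> I)"

definition DC_game_determined ::
  "('g, 'b) monoid_scheme \<Rightarrow> ('g \<Rightarrow> 'x \<Rightarrow> 'x) \<Rightarrow> 'x set set \<Rightarrow> bool" where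
  "DC_game_determined G \<phi> I \<longleftrightarrow> I_wins G \<phi> I \<or> II_wins G \<phi> I"

text \<open>Since V[[X]] is a proper class, it cannot be a HOL set. Instead, elements of
  V[[X]] are represented in an arbitrary type 'v carrying a well-founded,
  extensional membership relation mem with atoms atom x (x in X), closed under the
  extended action act. Every such structure embeds (Mostowski collapse) into
  V[[X]] compatibly with the action, and every element of V[[X]] (together with
  the Gamma-closure of its transitive closure) lives in such a structure for a large
  enough type 'v.\<close>

definition elts :: "('v \<Rightarrow> 'v \<Rightarrow> bool) \<Rightarrow> 'v \<Rightarrow> 'v set" where
  "elts mem b = {u. mem u b}"

definition atom_structure ::
  "('g, 'b) monoid_scheme \<Rightarrow> ('g \<Rightarrow> 'x \<Rightarrow> 'x) \<Rightarrow> 'x set \<Rightarrow>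
   ('x \<Rightarrow> 'v) \<Rightarrow> ('v \<Rightarrow> 'v \<Rightarrow> bool) \<Rightarrow> ('g \<Rightarrow> 'v \<Rightarrow> 'v) \<Rightarrow> bool" where
  "atom_structure G \<phi> X atom mem act \<longleftrightarrow>
     inj_on atom X \<and>
     (\<forall>x\<in>X. elts mem (atom x) = {}) \<and>
     wf {(u, v). mem u v} \<and>
     (\<forall>b c. b \<notin> atom ` X \<longrightarrow> c \<notin> atom ` X \<longrightarrow> elts mem b = elts mem c \<longrightarrow> b = c) \<and>
     (\<forall>g\<in>carrier G. \<forall>x\<in>X. act g (atom x) = atom (\<phi> g x)) \<and>
     (\<forall>g\<in>carrier G. \<forall>b. b \<notin> atom ` X \<longrightarrow>
        act g b \<notin> atom ` X \<and> elts mem (act g b) = act g ` elts mem b)"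

definition symmetric_elt ::
  "('g, 'b) monoid_scheme \<Rightarrow> ('g \<Rightarrow> 'x \<Rightarrow> 'x) \<Rightarrow> 'x set set \<Rightarrow> ('g \<Rightarrow> 'v \<Rightarrow> 'v) \<Rightarrow> 'v \<Rightarrow> bool" where
  "symmetric_elt G \<phi> I act A \<longleftrightarrow> (\<exists>b\<in>I. \<forall>g\<in>pstab G \<phi> b. act g A = A)"

definition in_W ::
  "('g, 'b) monoid_scheme \<Rightarrow> ('g \<Rightarrow> 'x \<Rightarrow> 'x) \<Rightarrow> 'x set set \<Rightarrow>
   ('v \<Rightarrow> 'v \<Rightarrow> bool) \<Rightarrow> ('g \<Rightarrow> 'v \<Rightarrow> 'v) \<Rightarrow> 'v \<Rightarrow> bool" where
  "in_W G \<phi> I mem act A \<longleftrightarrow>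
     (\<forall>u. (u, A) \<in> {(u, v). mem u v}\<^sup>* \<longrightarrow> symmetric_elt G \<phi> I act u)"

text \<open>W[[X]] contains a counterexample to DC: a nonempty partial order (P, R) in
  W[[X]] with no minimal element and no strictly descending sequence in W[[X]].
  P is an element of W[[X]] (a non-atom p with elts p = P). An order R on P
  (a set of ordered pairs of elements of W[[X]]) belongs to W[[X]] iff it is
  symmetric, i.e. fixed by pstab(b) for some b in I; a sequence s : omega -> P
  (a set of pairs (n, s n), with n pure) belongs to W[[X]] iff pstab(b) fixes
  every s n, for some b in I.\<close>
definition W_contains_DC_counterexample ::
  "('g, 'b) monoid_scheme \<Rightarrow> ('g \<Rightarrow> 'x \<Rightarrow> 'x) \<Rightarrow> 'x set \<Rightarrow> 'x set set \<Rightarrow>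
   ('x \<Rightarrow> 'v) \<Rightarrow> ('v \<Rightarrow> 'v \<Rightarrow> bool) \<Rightarrow> ('g \<Rightarrow> 'v \<Rightarrow> 'v) \<Rightarrow> bool" where
  "W_contains_DC_counterexample G \<phi> X I atom mem act \<longleftrightarrow>
     (\<exists>p R. p \<notin> atom ` X \<and> in_W G \<phi> I mem act p \<and>
        elts mem p \<noteq> {} \<and>
        R \<subseteq> elts mem p \<times> elts mem p \<and>
        refl_on (elts mem p) R \<and> antisym R \<and> trans R \<and>
        (\<exists>b\<in>I. \<forall>g\<in>pstab G \<phi> b. (\<lambda>(u, v). (act g u, act g v)) ` R = R) \<and>
        \<not> (\<exists>m\<in>elts mem p. \<forall>q\<in>elts mem p. (q, m) \<in> R \<longrightarrow> q = m) \<and>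
        \<not> (\<exists>s. (\<forall>n. s n \<in> elts mem p \<and> (s (Suc n), s n) \<in> R \<and> s (Suc n) \<noteq> s n) \<and>
               (\<exists>b\<in>I. \<forall>g\<in>pstab G \<phi> b. \<forall>n. act g (s n) = s n)))"

definition Polish_topology :: "'a topology \<Rightarrow> bool" where
  "Polish_topology T \<longleftrightarrow> separable_space T \<and> completely_metrizable_space T"

definition effros_borel :: "'a topology \<Rightarrow> 'a set measure" where
  "effros_borel T = sigma {F. closedin T F}
      {{F. closedin T F \<and> F \<inter> U \<noteq> {}} | U. openin T U}"

definition analytic_in :: "'a measure \<Rightarrow> 'a set \<Rightarrow> bool" where
  "analytic_in M A \<longleftrightarrow> A \<subseteq> space M \<and>
     (A = {} \<or> (\<exists>f \<in> (borel :: (nat \<Rightarrow> nat) measure) \<rightarrow>\<^sub>M M. range f = A))"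

end

theory Submission
  imports Defs
begin

text \<open>
  (1) Given a counterexample to DC, Player I builds a strictly descending sequence: at round \<open>n\<close>
  he chooses \<open>p\<^sub>n\<close> strictly below \<open>q\<^sub>n\<^sub>-\<^sub>1\<close>, where \<open>q\<^sub>m = \<gamma>\<^sub>m \<cdot> p\<^sub>m\<close>, and plays a support \<open>a\<^sub>n\<close> of
  \<open>p\<^sub>n\<close> that also supports the order. Then \<open>\<gamma>\<^sub>n \<cdot> a\<^sub>n\<close> supports \<open>q\<^sub>n\<close>, so the rules force \<open>\<gamma>\<^sub>n\<close> to fix
  all earlier \<open>q\<^sub>m\<close>, and the \<open>q\<^sub>n\<close> descend. If the union of the \<open>\<gamma>\<^sub>n \<cdot> a\<^sub>n\<close> were in the ideal, it would
  support the whole sequence.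

  (2) A closed set is determined by the basic open sets that it meets, and for an analytic family
  the patterns obtained in this way form the projection of a closed set of sequences. In the unfolded
  game Player II also plays, digit by digit, a point of that closed set coding a member of the family
  that covers the union. The payoff of the unfolded game is closed, so the game is determined.
  A winning strategy of II yields one in the DC game by forgetting the digits. For Player I, who
  does not see the digits, round \<open>n\<close> of the DC game is devoted to the answer of the unfolded strategy
  to the \<open>n\<close>-th finite sequence of digits: the rounds devoted to the initial segments of a fixed
  infinite sequence form a legal run of the unfolded game.
\<close>

section \<open>Supports and the extended action\<close>

definition supports ::
  "('g, 'b) monoid_scheme \<Rightarrow> ('g \<Rightarrow> 'x \<Rightarrow> 'x) \<Rightarrow> ('g \<Rightarrow> 'v \<Rightarrow> 'v) \<Rightarrow> 'x set \<Rightarrow> 'v \<Rightarrow> bool" where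
  "supports G \<phi> act a u \<longleftrightarrow> (\<forall>g\<in>pstab G \<phi> a. act g u = u)"

lemma pstab_antimono: "a \<subseteq> a' \<Longrightarrow> pstab G \<phi> a' \<subseteq> pstab G \<phi> a"
  by (auto simp: pstab_def)

lemma supports_mono: "supports G \<phi> act a u \<Longrightarrow> a \<subseteq> a' \<Longrightarrow> supports G \<phi> act a' u"
  unfolding supports_def using pstab_antimono[of a a' G \<phi>] by blast

context group_action
begin

lemma acting_group: "group G"
  using group_hom by (rule group_hom.axioms(1))

lemma one_action: "x \<in> E \<Longrightarrow> \<phi> \<one> x = x"
  by (metis id_eq_one restrict_apply')

lemma action_closed: "g \<in> carrier G \<Longrightarrow> x \<in> E \<Longrightarrow> \<phi> g x \<in> E"
  using element_image by blast

lemma pstab_conjugate: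
  assumes g: "g \<in> carrier G" and "a \<subseteq> E" and k: "k \<in> pstab G \<phi> (\<phi> g ` a)"
  shows "inv g \<otimes> (k \<otimes> g) \<in> pstab G \<phi> a"
proof -
  interpret group G by (rule acting_group)
  have kG: "k \<in> carrier G" using k by (simp add: pstab_def)
  have "\<phi> (inv g \<otimes> (k \<otimes> g)) x = x" if "x \<in> a" for x
  proof -
    have x: "x \<in> E" using that \<open>a \<subseteq> E\<close> by blast
    have "\<phi> k (\<phi> g x) = \<phi> g x" using k that by (simp add: pstab_def)
    then show ?thesis
      using x g kG orbit_sym_aux[OF g x refl] by (simp add: composition_rule action_closed)
  qed
  then show ?thesis using g kG by (simp add: pstab_def)
qed

end

lemma supports_translate:
  assumes "group_action G X \<phi>" and "group_action G E act"
    and g: "g \<in> carrier G" and "a \<subseteq> X" and "u \<in> E" and supp: "supports G \<phi> act a u"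
  shows "supports G \<phi> act (\<phi> g ` a) (act g u)"
  unfolding supports_def
proof
  interpret \<phi>: group_action G X \<phi> by fact
  interpret act: group_action G E act by fact
  interpret group G by (rule \<phi>.acting_group)
  fix k assume k: "k \<in> pstab G \<phi> (\<phi> g ` a)"
  then have kG: "k \<in> carrier G" by (simp add: pstab_def)
  let ?c = "inv\<^bsub>G\<^esub> g \<otimes>\<^bsub>G\<^esub> (k \<otimes>\<^bsub>G\<^esub> g)"
  have "act k (act g u) = act (k \<otimes>\<^bsub>G\<^esub> g) u"
    using g kG \<open>u \<in> E\<close> by (simp add: act.composition_rule)
  also have "k \<otimes>\<^bsub>G\<^esub> g = g \<otimes>\<^bsub>G\<^esub> ?c"
    using g kG by (simp add: m_assoc[symmetric])
  also have "act (g \<otimes>\<^bsub>G\<^esub> ?c) u = act g (act ?c u)"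
    using g kG \<open>u \<in> E\<close> by (simp add: act.composition_rule)
  also have "act ?c u = u"
    using \<phi>.pstab_conjugate[OF g \<open>a \<subseteq> X\<close> k] supp by (simp add: supports_def)
  finally show "act k (act g u) = act g u" .
qed

lemma (in group) group_action_UNIV_I:
  assumes one: "act \<one> = id"
    and mult: "\<And>g h. g \<in> carrier G \<Longrightarrow> h \<in> carrier G \<Longrightarrow> act (g \<otimes> h) = act g \<circ> act h"
  shows "group_action G UNIV act"
proof -
  have "bij (act g)" if g: "g \<in> carrier G" for g
  proof (rule o_bij)
    show "act (inv g) \<circ> act g = id" "act g \<circ> act (inv g) = id"
      using g mult[of "inv g" g] mult[of g "inv g"] one by simp_all
  qed
  then show ?thesis
    by (intro group_action.intro group_hom.intro group_hom_axioms.intro homI is_group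
        group_BijGroup)
      (auto simp: BijGroup_def Bij_def mult compose_def fun_eq_iff)
qed

definition mem_hom ::
  "'x set \<Rightarrow> ('x \<Rightarrow> 'v) \<Rightarrow> ('v \<Rightarrow> 'v \<Rightarrow> bool) \<Rightarrow> ('v \<Rightarrow> 'v) \<Rightarrow> bool" where
  "mem_hom X atom mem f \<longleftrightarrow>
     (\<forall>b. b \<notin> atom ` X \<longrightarrow> f b \<notin> atom ` X \<and> elts mem (f b) = f ` elts mem b)"

lemma mem_hom_id: "mem_hom X atom mem id"
  by (simp add: mem_hom_def)

lemma mem_hom_comp:
  "mem_hom X atom mem f \<Longrightarrow> mem_hom X atom mem h \<Longrightarrow> mem_hom X atom mem (f \<circ> h)"
  by (simp add: mem_hom_def image_comp)

lemma atom_structure_mem_hom: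
  "atom_structure G \<phi> X atom mem act \<Longrightarrow> g \<in> carrier G \<Longrightarrow> mem_hom X atom mem (act g)"
  by (simp add: atom_structure_def mem_hom_def)

lemma mem_hom_unique:
  assumes atom_str: "atom_structure G \<phi> X atom mem act"
    and f: "mem_hom X atom mem f" and h: "mem_hom X atom mem h"
    and atoms: "\<And>x. x \<in> X \<Longrightarrow> f (atom x) = h (atom x)"
  shows "f = h"
proof
  fix b
  have "wf {(u, v). mem u v}" using atom_str by (simp add: atom_structure_def)
  then show "f b = h b"
  proof (induction b rule: wf_induct_rule)
    case (less b)
    show ?case
    proof (cases "b \<in> atom ` X")
      case True
      then show ?thesis using atoms by blast
    next
      case False
      have "f ` elts mem b = h ` elts mem b"
        using less by (intro image_cong) (auto simp: elts_def)
      then have "f b \<notin> atom ` X" "h b \<notin> atom ` X" "elts mem (f b) = elts mem (h b)"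
        using f h False by (simp_all add: mem_hom_def)
      then show ?thesis using atom_str by (simp add: atom_structure_def)
    qed
  qed
qed

lemma atom_structure_group_action:
  assumes "group_action G X \<phi>" and atom_str: "atom_structure G \<phi> X atom mem act"
  shows "group_action G UNIV act"
proof -
  interpret group_action G X \<phi> by fact
  interpret group G by (rule acting_group)
  have act_atom: "act g (atom x) = atom (\<phi> g x)" if "g \<in> carrier G" "x \<in> X" for g x
    using atom_str that by (simp add: atom_structure_def)
  note hom = atom_structure_mem_hom[OF atom_str]
  show ?thesis
  proof (rule group_action_UNIV_I)
    show "act \<one>\<^bsub>G\<^esub> = id"
      by (rule mem_hom_unique[OF atom_str hom mem_hom_id]) (simp_all add: act_atom one_action)
    show "act (g \<otimes>\<^bsub>G\<^esub> h) = act g \<circ> act h" if "g \<in> carrier G" "h \<in> carrier G" for g h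
      by (rule mem_hom_unique[OF atom_str hom mem_hom_comp[OF hom hom]])
        (use that in \<open>simp_all add: act_atom composition_rule action_closed\<close>)
  qed
qed

section \<open>Failure of dependent choices\<close>

lemma legal_run_mem_pstab:
  "legal_run G \<phi> a g \<Longrightarrow> m < n \<Longrightarrow> g n \<in> pstab G \<phi> (\<phi> (g m) ` a m)"
  unfolding legal_run_def pstab_def by blast

lemma (in group_action) legal_run_mem_pstab_first:
  assumes legal: "legal_run G \<phi> a g" and b: "b \<subseteq> a 0" "b \<subseteq> E"
  shows "g n \<in> pstab G \<phi> b"
proof -
  have g0: "g 0 = \<one>" and gG: "g n \<in> carrier G" using legal by (simp_all add: legal_run_def)
  have fix_b: "\<phi> (g 0) x = x" if "x \<in> b" for x
    using that b(2) g0 one_action by auto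
  show ?thesis
  proof (cases "n = 0")
    case True
    then show ?thesis using fix_b gG by (auto simp: pstab_def)
  next
    case False
    have "b \<subseteq> \<phi> (g 0) ` a 0" using fix_b b(1) by force
    then show ?thesis
      using subsetD[OF pstab_antimono legal_run_mem_pstab[OF legal, of 0 n]] False by simp
  qed
qed

locale symmetric_relation =
  fixes G :: "('g, 'b) monoid_scheme" and \<phi> :: "'g \<Rightarrow> 'x \<Rightarrow> 'x" and X I
    and E :: "'v set" and act :: "'g \<Rightarrow> 'v \<Rightarrow> 'v" and P S b
  assumes dynamical_ideal: "dynamical_ideal G \<phi> X I"
    and action: "group_action G E act"
    and field_subset: "P \<subseteq> E"
    and support_mem: "b \<in> I"
    and field_invariant: "k \<in> pstab G \<phi> b \<Longrightarrow> u \<in> P \<Longrightarrow> act k u \<in> P"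
    and relation_invariant: "k \<in> pstab G \<phi> b \<Longrightarrow> (u, v) \<in> S \<Longrightarrow> (act k u, act k v) \<in> S"
    and symmetric: "q \<in> P \<Longrightarrow> \<exists>a\<in>I. supports G \<phi> act a q"
begin

lemma atom_action: "group_action G X \<phi>" and ideal_subset: "a \<in> I \<Longrightarrow> a \<subseteq> X"
  using dynamical_ideal by (auto simp: dynamical_ideal_def)

lemma support_containing:
  "\<exists>a\<in>I. b \<subseteq> a \<and> (q \<in> P \<longrightarrow> supports G \<phi> act a q)"
proof -
  obtain a where "a \<in> I" "q \<in> P \<longrightarrow> supports G \<phi> act a q"
    using symmetric support_mem by blast
  moreover have "b \<union> a \<in> I"
    using dynamical_ideal support_mem \<open>a \<in> I\<close> by (simp add: dynamical_ideal_def)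
  ultimately show ?thesis by (intro bexI[of _ "b \<union> a"]) (auto intro: supports_mono)
qed

lemma legal_run_descends:
  assumes legal: "legal_run G \<phi> a g" and a: "\<And>n. b \<subseteq> a n" "\<And>n. a n \<subseteq> X"
    and supp: "\<And>n. r n \<in> P \<Longrightarrow> supports G \<phi> act (a n) (r n)"
    and r_0: "r 0 \<in> P"
    and r_Suc: "\<And>n. act (g n) (r n) \<in> P \<Longrightarrow> r (Suc n) \<in> P \<and> (r (Suc n), act (g n) (r n)) \<in> S"
  defines "s \<equiv> \<lambda>n. act (g n) (r n)"
  shows "s n \<in> P" and "(s (Suc n), s n) \<in> S" and "supports G \<phi> act (run_union \<phi> a g) (s n)"
proof -
  have g: "g n \<in> carrier G" "g n \<in> pstab G \<phi> b" for n
    using group_action.legal_run_mem_pstab_first[OF atom_action legal a(1)] a[of 0]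
    by (auto simp: pstab_def)
  have r: "r n \<in> P" for n
    by (induction n) (use r_0 r_Suc field_invariant[OF g(2)] in blast)+
  then show s: "s n \<in> P" for n using field_invariant[OF g(2)] by (simp add: s_def)
  have s_supp: "supports G \<phi> act (\<phi> (g n) ` a n) (s n)" for n
    unfolding s_def using supports_translate[OF atom_action action g(1) a(2) _ supp] r field_subset
    by blast
  then show "supports G \<phi> act (run_union \<phi> a g) (s n)"
    by (rule supports_mono) (auto simp: run_union_def)
  have "act (g (Suc n)) (s n) = s n"
    using s_supp[of n] legal_run_mem_pstab[OF legal, of n "Suc n"] by (simp add: supports_def)
  moreover have "(r (Suc n), s n) \<in> S" using r_Suc s by (simp add: s_def)
  then have "(s (Suc n), act (g (Suc n)) (s n)) \<in> S"
    unfolding s_def by (rule relation_invariant[OF g(2)])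
  ultimately show "(s (Suc n), s n) \<in> S" by simp
qed

theorem I_wins_if_no_symmetric_descent:
  assumes "P \<noteq> {}" and no_min: "\<And>q. q \<in> P \<Longrightarrow> \<exists>q'\<in>P. (q', q) \<in> S"
    and no_desc: "\<And>s a. (\<And>n. s n \<in> P) \<Longrightarrow> (\<And>n. (s (Suc n), s n) \<in> S) \<Longrightarrow> a \<in> I \<Longrightarrow>
      (\<And>n. supports G \<phi> act a (s n)) \<Longrightarrow> False"
  shows "I_wins G \<phi> I"
proof -
  obtain p where p: "p \<in> P" using \<open>P \<noteq> {}\<close> by blast
  obtain below where below: "\<And>q. q \<in> P \<Longrightarrow> below q \<in> P \<and> (below q, q) \<in> S"
    using no_min by metis
  obtain supp where supp: "\<And>q. supp q \<in> I \<and> b \<subseteq> supp q \<and> (q \<in> P \<longrightarrow> supports G \<phi> act (supp q) q)"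
    using support_containing by metis
  define choice where "choice = foldl (\<lambda>q k. below (act k q)) p"
  have "run_union \<phi> (\<lambda>n. supp (choice (map g [0..<n]))) g \<notin> I"
    if legal: "legal_run G \<phi> (\<lambda>n. supp (choice (map g [0..<n]))) g" for g
  proof
    let ?a = "\<lambda>n. supp (choice (map g [0..<n]))"
    define r where "r n = choice (map g [0..<n])" for n
    have r_0: "r 0 \<in> P" and r_Suc: "r (Suc n) = below (act (g n) (r n))" for n
      using p by (simp_all add: r_def choice_def)
    have supp_r: "supports G \<phi> act (?a n) (r n)" if "r n \<in> P" for n
      using supp that by (simp add: r_def)
    have "b \<subseteq> ?a n" "?a n \<subseteq> X" for n using supp ideal_subset by blast+
    note descends = legal_run_descends[OF legal this supp_r r_0]
    assume "run_union \<phi> ?a g \<in> I"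
    then show False
      by (rule no_desc[rotated 2]) (rule descends; simp add: r_Suc below)+
  qed
  then show ?thesis
    unfolding I_wins_def using supp by (intro exI[of _ "\<lambda>h. supp (choice h)"]) blast
qed

end

lemma elts_closed_under_support:
  assumes atom_str: "atom_structure G \<phi> X atom mem act" and "p \<notin> atom ` X"
    and "supports G \<phi> act a p" and k: "k \<in> pstab G \<phi> a" and "u \<in> elts mem p"
  shows "act k u \<in> elts mem p"
proof -
  have "elts mem (act k p) = act k ` elts mem p"
    using atom_structure_mem_hom[OF atom_str] \<open>p \<notin> atom ` X\<close> k by (simp add: mem_hom_def pstab_def)
  moreover have "act k p = p" using assms(3) k by (simp add: supports_def)
  ultimately show ?thesis using \<open>u \<in> elts mem p\<close> by auto
qed

lemma symmetric_relation_in_W: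
  assumes dyn: "dynamical_ideal G \<phi> X I" and atom_str: "atom_structure G \<phi> X atom mem act"
    and p: "p \<notin> atom ` X" "in_W G \<phi> I mem act p"
    and R: "bR \<in> I" "\<And>k. k \<in> pstab G \<phi> bR \<Longrightarrow> (\<lambda>(u, v). (act k u, act k v)) ` R = R"
  shows "\<exists>b. symmetric_relation G \<phi> X I UNIV act (elts mem p) (R - Id) b"
proof -
  have action: "group_action G UNIV act"
    using dyn atom_structure_group_action[OF _ atom_str] by (simp add: dynamical_ideal_def)
  obtain bp where bp: "bp \<in> I" "supports G \<phi> act bp p"
    using p(2) by (auto simp: in_W_def symmetric_elt_def supports_def)
  have fixes_union: "k \<in> pstab G \<phi> bR" "k \<in> pstab G \<phi> bp" "k \<in> carrier G"
    if "k \<in> pstab G \<phi> (bR \<union> bp)" for k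
    using that by (auto simp: pstab_def)
  have "symmetric_relation G \<phi> X I UNIV act (elts mem p) (R - Id) (bR \<union> bp)"
  proof (rule symmetric_relation.intro)
    show "bR \<union> bp \<in> I" using dyn R(1) bp(1) by (simp add: dynamical_ideal_def)
    show "act k u \<in> elts mem p" if "k \<in> pstab G \<phi> (bR \<union> bp)" "u \<in> elts mem p" for k u
      using elts_closed_under_support[OF atom_str p(1) bp(2) fixes_union(2)] that by blast
    show "(act k u, act k v) \<in> R - Id"
      if k: "k \<in> pstab G \<phi> (bR \<union> bp)" and uv: "(u, v) \<in> R - Id" for k u v
    proof -
      have "(act k u, act k v) \<in> R" using uv R(2)[OF fixes_union(1)[OF k]] by force
      moreover have "act k u \<noteq> act k v"
        using uv group_action.inj_prop[OF action fixes_union(3)[OF k]] by (auto dest: injD)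
      ultimately show ?thesis by blast
    qed
    show "\<exists>a\<in>I. supports G \<phi> act a q" if "q \<in> elts mem p" for q
      using p(2) that unfolding in_W_def symmetric_elt_def supports_def elts_def by blast
  qed (use dyn action in auto)
  then show ?thesis ..
qed

theorem DC_counterexample_imp_I_wins:
  assumes dyn: "dynamical_ideal G \<phi> X I" and atom_str: "atom_structure G \<phi> X atom mem act"
    and counterexample: "W_contains_DC_counterexample G \<phi> X I atom mem act"
  shows "I_wins G \<phi> I"
proof -
  obtain p R where p: "p \<notin> atom ` X" "in_W G \<phi> I mem act p" "elts mem p \<noteq> {}"
    and R: "\<exists>b\<in>I. \<forall>g\<in>pstab G \<phi> b. (\<lambda>(u, v). (act g u, act g v)) ` R = R"
    and no_min: "\<not> (\<exists>m\<in>elts mem p. \<forall>q\<in>elts mem p. (q, m) \<in> R \<longrightarrow> q = m)"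
    and no_desc: "\<not> (\<exists>s. (\<forall>n. s n \<in> elts mem p \<and> (s (Suc n), s n) \<in> R \<and> s (Suc n) \<noteq> s n) \<and>
               (\<exists>b\<in>I. \<forall>g\<in>pstab G \<phi> b. \<forall>n. act g (s n) = s n))"
    using counterexample unfolding W_contains_DC_counterexample_def by blast
  obtain bR where "bR \<in> I"
    "\<And>k. k \<in> pstab G \<phi> bR \<Longrightarrow> (\<lambda>(u, v). (act k u, act k v)) ` R = R"
    using R by blast
  then obtain b where "symmetric_relation G \<phi> X I UNIV act (elts mem p) (R - Id) b"
    using symmetric_relation_in_W[OF dyn atom_str p(1,2)] by metis
  then interpret symmetric_relation G \<phi> X I UNIV act "elts mem p" "R - Id" b .
  show ?thesis
  proof (rule I_wins_if_no_symmetric_descent[OF p(3)])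
    show "\<exists>q'\<in>elts mem p. (q', q) \<in> R - Id" if "q \<in> elts mem p" for q
      using no_min that by blast
    show False if "\<And>n. s n \<in> elts mem p" "\<And>n. (s (Suc n), s n) \<in> R - Id"
      "a \<in> I" "\<And>n. supports G \<phi> act a (s n)" for s a
      using no_desc that unfolding supports_def by blast
  qed
qed

section \<open>Determinacy of closed games\<close>

definition sequence_topology :: "(nat \<Rightarrow> 'a) topology" where
  "sequence_topology = product_topology (\<lambda>_. discrete_topology UNIV) UNIV"

lemma openin_sequence_topology_iff:
  "openin sequence_topology U \<longleftrightarrow> (\<forall>r\<in>U. \<exists>n. {s. \<forall>i<n. s i = r i} \<subseteq> U)"
proof (intro iffI ballI)
  fix r assume "openin sequence_topology U" "r \<in> U"
  then obtain V where V: "finite {i. V i \<noteq> UNIV}" "r \<in> Pi\<^sub>E UNIV V" "Pi\<^sub>E UNIV V \<subseteq> U"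
    unfolding sequence_topology_def openin_product_topology_alt by auto
  obtain n where "{i. V i \<noteq> UNIV} \<subseteq> {..<n}" using V(1) finite_nat_iff_bounded by blast
  then have "s i \<in> V i" if "\<forall>i<n. s i = r i" for s i
    using V(2) that by (cases "i < n") (auto simp: PiE_iff)
  then have "{s. \<forall>i<n. s i = r i} \<subseteq> Pi\<^sub>E UNIV V" by (auto simp: PiE_iff)
  then show "\<exists>n. {s. \<forall>i<n. s i = r i} \<subseteq> U" using V(3) by (meson order_trans)
next
  assume cylinders: "\<forall>r\<in>U. \<exists>n. {s. \<forall>i<n. s i = r i} \<subseteq> U"
  show "openin sequence_topology U"
    unfolding sequence_topology_def openin_product_topology_alt
  proof
    fix r assume "r \<in> U"
    then obtain n where n: "{s. \<forall>i<n. s i = r i} \<subseteq> U" using cylinders by blast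
    let ?V = "\<lambda>i. if i < n then {r i} else UNIV"
    have "finite {i \<in> UNIV. ?V i \<noteq> topspace (discrete_topology UNIV)}"
      by (rule finite_subset[of _ "{..<n}"]) auto
    moreover have "Pi\<^sub>E UNIV ?V \<subseteq> U" using n by (auto simp: PiE_iff split: if_splits)
    ultimately show "\<exists>V. finite {i \<in> UNIV. V i \<noteq> topspace (discrete_topology UNIV)} \<and>
        (\<forall>i\<in>UNIV. openin (discrete_topology UNIV) (V i)) \<and> r \<in> Pi\<^sub>E UNIV V \<and> Pi\<^sub>E UNIV V \<subseteq> U"
      by (intro exI[of _ ?V]) auto
  qed
qed

lemma closedin_sequence_topology_iff:
  "closedin sequence_topology W \<longleftrightarrow> (\<forall>r. (\<forall>n. \<exists>s\<in>W. \<forall>i<n. s i = r i) \<longrightarrow> r \<in> W)"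
proof -
  define near where "near r n \<longleftrightarrow> (\<exists>s\<in>W. \<forall>i<n. s i = r i)" for r n
  have "{s. \<forall>i<n. s i = r i} \<subseteq> - W \<longleftrightarrow> \<not> near r n" for r n
    unfolding near_def by blast
  then have "openin sequence_topology (- W) \<longleftrightarrow> (\<forall>r. (\<forall>n. near r n) \<longrightarrow> r \<in> W)"
    unfolding openin_sequence_topology_iff by auto
  then show ?thesis
    by (simp add: near_def closedin_def sequence_topology_def Compl_eq_Diff_UNIV)
qed

lemma sequence_topology_nat: "sequence_topology = (euclidean :: (nat \<Rightarrow> nat) topology)"
proof -
  have "discrete_topology UNIV = (euclidean :: nat topology)"
    by (simp add: discrete_topology_unique open_discrete)
  then show ?thesis by (simp add: sequence_topology_def euclidean_product_topology)
qed

definition first_player_wins :: "'a set \<Rightarrow> (nat \<Rightarrow> 'a \<times> 'b) set \<Rightarrow> bool" where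
  "first_player_wins A W \<longleftrightarrow>
     (\<exists>\<sigma>. (\<forall>u. \<sigma> u \<in> A) \<and> (\<forall>b. (\<lambda>n. (\<sigma> (map b [0..<n]), b n)) \<notin> W))"

definition second_player_wins :: "'a set \<Rightarrow> (nat \<Rightarrow> 'a \<times> 'b) set \<Rightarrow> bool" where
  "second_player_wins A W \<longleftrightarrow>
     (\<exists>\<tau>. \<forall>a. (\<forall>n. a n \<in> A) \<longrightarrow> (\<lambda>n. (a n, \<tau> (map a [0..<Suc n]))) \<in> W)"

definition continuations :: "'a \<Rightarrow> (nat \<Rightarrow> 'a) set \<Rightarrow> (nat \<Rightarrow> 'a) set" where
  "continuations p W = {r. case_nat p r \<in> W}"

lemma first_player_wins_empty: "a \<in> A \<Longrightarrow> first_player_wins A {}"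
  unfolding first_player_wins_def by (intro exI[of _ "\<lambda>_. a"]) simp

lemma first_player_wins_if_continuations:
  assumes "a \<in> A" and wins: "\<And>b. first_player_wins A (continuations (a, b) W)"
  shows "first_player_wins A W"
proof -
  obtain S where S_mem: "\<And>c u. S c u \<in> A"
    and S: "\<And>c b. (\<lambda>n. (S c (map b [0..<n]), b n)) \<notin> continuations (a, c) W"
    using wins unfolding first_player_wins_def by metis
  define \<sigma> where "\<sigma> = case_list a S"
  have "(\<lambda>n. (\<sigma> (map b [0..<n]), b n)) \<notin> W" for b
  proof -
    have "(\<lambda>n. (\<sigma> (map b [0..<n]), b n)) =
        case_nat (a, b 0) (\<lambda>n. (S (b 0) (map (b \<circ> Suc) [0..<n]), (b \<circ> Suc) n))"
      by (rule ext) (simp add: \<sigma>_def map_upt_Suc comp_def split: nat.split del: upt_Suc)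
    then show ?thesis using S[of "b 0" "b \<circ> Suc"] by (simp add: continuations_def)
  qed
  moreover have "\<sigma> u \<in> A" for u using assms(1) S_mem by (simp add: \<sigma>_def split: list.split)
  ultimately show ?thesis unfolding first_player_wins_def by blast
qed

lemma iterated_continuations:
  assumes "V 0 = W" and V_Suc: "\<And>n. V (Suc n) = continuations (r n) (V n)" and "s \<in> V n"
  shows "(\<lambda>i. if i < n then r i else s (i - n)) \<in> W"
  using assms(3)
proof (induction n arbitrary: s)
  case 0
  then show ?case using assms(1) by simp
next
  case (Suc n)
  then have "case_nat (r n) s \<in> V n" by (simp add: V_Suc continuations_def)
  then have "(\<lambda>i. if i < n then r i else case_nat (r n) s (i - n)) \<in> W" by (rule Suc.IH)
  also have "(\<lambda>i. if i < n then r i else case_nat (r n) s (i - n)) =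
      (\<lambda>i. if i < Suc n then r i else s (i - Suc n))"
    by (auto simp: fun_eq_iff less_Suc_eq diff_Suc split: nat.split)
  finally show ?case .
qed

theorem closed_game_determined:
  fixes W :: "(nat \<Rightarrow> 'a \<times> 'b) set"
  assumes closed: "closedin sequence_topology W"
  shows "first_player_wins A W \<or> second_player_wins A W"
proof (subst disj_commute, rule disjCI)
  assume "\<not> first_player_wins A W"
  obtain reply :: "(nat \<Rightarrow> 'a \<times> 'b) set \<Rightarrow> 'a \<Rightarrow> 'b" where reply: "\<And>V a. \<not> first_player_wins A V \<Longrightarrow> a \<in> A \<Longrightarrow>
      \<not> first_player_wins A (continuations (a, reply V a) V)"
    using first_player_wins_if_continuations by metis
  define remaining where "remaining = foldl (\<lambda>V a. continuations (a, reply V a) V) W"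
  define \<tau> where "\<tau> u = reply (remaining (butlast u)) (last u)" for u
  have "(\<lambda>n. (a n, \<tau> (map a [0..<Suc n]))) \<in> W" if a: "\<forall>n. a n \<in> A" for a
  proof -
    define r where "r n = (a n, \<tau> (map a [0..<Suc n]))" for n
    define V where "V n = remaining (map a [0..<n])" for n
    have V_0: "V 0 = W" and V_Suc: "V (Suc n) = continuations (r n) (V n)" for n
      by (simp_all add: V_def r_def remaining_def \<tau>_def)
    have r: "r n = (a n, reply (V n) (a n))" for n by (simp add: r_def \<tau>_def V_def)
    have "\<not> first_player_wins A (V n)" for n
      by (induction n) (use \<open>\<not> first_player_wins A W\<close> a reply V_0 V_Suc r in auto)
    then have "\<forall>n. \<exists>s. s \<in> V n" using first_player_wins_empty a by (metis ex_in_conv)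
    then obtain s where "\<And>n. s n \<in> V n" by metis
    then have "(\<lambda>i. if i < n then r i else s n (i - n)) \<in> W" for n
      by (rule iterated_continuations[OF V_0 V_Suc])
    then have "\<exists>s\<in>W. \<forall>i<n. s i = r i" for n
      by (intro bexI[of _ "\<lambda>i. if i < n then r i else s n (i - n)"]) simp_all
    then show ?thesis using closed by (simp add: closedin_sequence_topology_iff r_def)
  qed
  then show "second_player_wins A W" unfolding second_player_wins_def by blast
qed

section \<open>The unfolded game\<close>

definition unfolded_payoff ::
  "('g, 'b) monoid_scheme \<Rightarrow> ('g \<Rightarrow> 'x \<Rightarrow> 'x) \<Rightarrow> (nat \<Rightarrow> 'd) set \<Rightarrow> ((nat \<Rightarrow> 'd) \<Rightarrow> 'x set) \<Rightarrow>
    (nat \<Rightarrow> 'x set \<times> 'g \<times> 'd) set" where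
  "unfolded_payoff G \<phi> D F =
     {\<lambda>n. (a n, g n, y n) |a g y. legal_run G \<phi> a g \<and> y \<in> D \<and> run_union \<phi> a g \<subseteq> F y}"

lemma mem_unfolded_payoff_iff:
  "(\<lambda>n. (a n, g n, y n)) \<in> unfolded_payoff G \<phi> D F \<longleftrightarrow>
     legal_run G \<phi> a g \<and> y \<in> D \<and> run_union \<phi> a g \<subseteq> F y"
proof -
  have "(\<lambda>n. (a n, g n, y n)) = (\<lambda>n. (a' n, g' n, y' n)) \<longleftrightarrow> a = a' \<and> g = g' \<and> y = y'"
    for a' :: "nat \<Rightarrow> 'a set" and g' y'
    by (auto simp: fun_eq_iff)
  then show ?thesis by (simp add: unfolded_payoff_def)
qed

lemma legal_run_limit:
  assumes approx: "\<And>n. \<exists>a' g'. legal_run G \<phi> a' g' \<and> (\<forall>i<n. a' i = a i \<and> g' i = g i)"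
  shows "legal_run G \<phi> a g"
  unfolding legal_run_def
proof (intro conjI allI ballI)
  show "g n \<in> carrier G" for n
    using approx[of "Suc n"] unfolding legal_run_def by (metis lessI)
  show "g 0 = \<one>\<^bsub>G\<^esub>"
    using approx[of 1] unfolding legal_run_def by (metis zero_less_one)
  fix n x assume "x \<in> (\<Union>m<n. \<phi> (g m) ` a m)"
  then obtain m where "m < n" "x \<in> \<phi> (g m) ` a m" by blast
  moreover obtain a' g' where "legal_run G \<phi> a' g'" "\<forall>i<Suc n. a' i = a i \<and> g' i = g i"
    using approx by blast
  ultimately show "\<phi> (g n) x = x"
    using legal_run_mem_pstab[of G \<phi> a' g' m n] by (auto simp: pstab_def)
qed

lemma closedin_unfolded_payoff:
  fixes G :: "('g, 'b) monoid_scheme" and \<phi> :: "'g \<Rightarrow> 'x \<Rightarrow> 'x" and D :: "(nat \<Rightarrow> 'd) set"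
  assumes D: "closedin sequence_topology D"
    and F: "\<And>x. closedin sequence_topology {y \<in> D. x \<in> F y}"
  shows "closedin sequence_topology (unfolded_payoff G \<phi> D F)"
  unfolding closedin_sequence_topology_iff
proof (intro allI impI)
  fix r :: "nat \<Rightarrow> 'x set \<times> 'g \<times> 'd"
  define a g y where "a n = fst (r n)" and "g n = fst (snd (r n))" and "y n = snd (snd (r n))" for n
  have r: "r = (\<lambda>n. (a n, g n, y n))" by (simp add: a_def g_def y_def)
  assume limit: "\<forall>n. \<exists>s\<in>unfolded_payoff G \<phi> D F. \<forall>i<n. s i = r i"
  then have approx: "\<exists>a' g' y'. legal_run G \<phi> a' g' \<and> y' \<in> D \<and> run_union \<phi> a' g' \<subseteq> F y' \<and>
      (\<forall>i<n. a' i = a i \<and> g' i = g i \<and> y' i = y i)" for n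
  proof -
    obtain s where "s \<in> unfolded_payoff G \<phi> D F" "\<forall>i<n. s i = r i" using limit by blast
    moreover from this(1) obtain a' g' y' where "s = (\<lambda>n. (a' n, g' n, y' n))"
      "legal_run G \<phi> a' g'" "y' \<in> D" "run_union \<phi> a' g' \<subseteq> F y'"
      unfolding unfolded_payoff_def by blast
    ultimately show ?thesis
      unfolding r by (intro exI[of _ a'] exI[of _ g'] exI[of _ y']) simp
  qed
  have "\<exists>a' g'. legal_run G \<phi> a' g' \<and> (\<forall>i<n. a' i = a i \<and> g' i = g i)" for n
    using approx[of n] by metis
  then have "legal_run G \<phi> a g" by (rule legal_run_limit)
  moreover have "y \<in> D"
    using D approx unfolding closedin_sequence_topology_iff by metis
  moreover have "run_union \<phi> a g \<subseteq> F y"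
  proof
    fix x assume "x \<in> run_union \<phi> a g"
    then obtain m where m: "x \<in> \<phi> (g m) ` a m" by (auto simp: run_union_def)
    have "\<exists>y'\<in>{y \<in> D. x \<in> F y}. \<forall>i<n. y' i = y i" for n
    proof -
      obtain a' g' y' where "y' \<in> D" "run_union \<phi> a' g' \<subseteq> F y'"
        and agree: "\<forall>i<max n (Suc m). a' i = a i \<and> g' i = g i \<and> y' i = y i"
        using approx by blast
      moreover have "x \<in> run_union \<phi> a' g'"
        using m agree[rule_format, of m] unfolding run_union_def by (intro UN_I[of m]) simp_all
      ultimately show ?thesis by auto
    qed
    then have "y \<in> {y \<in> D. x \<in> F y}"
      using F[of x] unfolding closedin_sequence_topology_iff by blast
    then show "x \<in> F y" by blast
  qed
  ultimately show "r \<in> unfolded_payoff G \<phi> D F" by (simp add: r mem_unfolded_payoff_iff)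
qed

lemma legal_run_subsequence:
  assumes legal: "legal_run G \<phi> a g" and c: "strict_mono c" "c 0 = 0"
  shows "legal_run G \<phi> (a \<circ> c) (g \<circ> c)"
  unfolding legal_run_def
proof (intro conjI allI ballI)
  show "(g \<circ> c) n \<in> carrier G" "(g \<circ> c) 0 = \<one>\<^bsub>G\<^esub>" for n
    using legal c(2) by (simp_all add: legal_run_def)
  fix n x assume "x \<in> (\<Union>m<n. \<phi> ((g \<circ> c) m) ` (a \<circ> c) m)"
  then obtain m where "m < n" "x \<in> \<phi> (g (c m)) ` a (c m)" by auto
  moreover from this have "c m < c n" using c(1) strict_monoD by blast
  ultimately show "\<phi> ((g \<circ> c) n) x = x"
    using legal_run_mem_pstab[OF legal, of "c m" "c n"] by (auto simp: pstab_def)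
qed

lemma run_union_subsequence: "run_union \<phi> (a \<circ> c) (g \<circ> c) \<subseteq> run_union \<phi> a g"
  by (auto simp: run_union_def)

text \<open>The library's code of a list grows when an element is prepended; reversing makes the code of a
  sequence of digits exceed the codes of its proper initial segments.\<close>

definition digits_code :: "nat list \<Rightarrow> nat" where
  "digits_code ds = list_encode (rev ds)"

definition digits_decode :: "nat \<Rightarrow> nat list" where
  "digits_decode n = rev (list_decode n)"

lemma digits_decode_code [simp]: "digits_decode (digits_code ds) = ds"
  by (simp add: digits_code_def digits_decode_def)

lemma strict_mono_digits_code_prefix: "strict_mono (\<lambda>j. digits_code (map y [0..<j]))"
  unfolding strict_mono_Suc_iff
  by (simp add: digits_code_def less_Suc_eq_le le_prod_encode_2)

text \<open>The opponent's simulated move paired with a digit is the one played in the real round whose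
  number codes the preceding digits.\<close>

definition simulated_history :: "'g list \<Rightarrow> nat list \<Rightarrow> ('g \<times> nat) list" where
  "simulated_history h ds = map (\<lambda>i. (h ! digits_code (take i ds), ds ! i)) [0..<length ds]"

lemma simulated_history_prefix:
  "simulated_history (map g [0..<digits_code (map y [0..<j])]) (map y [0..<j]) =
    map (\<lambda>i. (g (digits_code (map y [0..<i])), y i)) [0..<j]"
proof -
  have "digits_code (map y [0..<i]) < digits_code (map y [0..<j])" if "i < j" for i
    using strict_monoD[OF strict_mono_digits_code_prefix that] .
  then show ?thesis by (simp add: simulated_history_def take_map)
qed

lemma unfolded_first_player_wins_imp_I_wins:
  fixes D :: "(nat \<Rightarrow> nat) set"
  assumes wins: "first_player_wins I (unfolded_payoff G \<phi> D F)"
    and cover: "\<And>A. A \<in> I \<Longrightarrow> \<exists>y\<in>D. A \<subseteq> F y"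
  shows "I_wins G \<phi> I"
proof -
  obtain \<sigma> where \<sigma>_mem: "\<And>u. \<sigma> u \<in> I"
    and \<sigma>: "\<And>b. (\<lambda>n. (\<sigma> (map b [0..<n]), b n)) \<notin> unfolded_payoff G \<phi> D F"
    using wins unfolding first_player_wins_def by blast
  define \<rho> where "\<rho> h = \<sigma> (simulated_history h (digits_decode (length h)))" for h
  have "run_union \<phi> (\<lambda>n. \<rho> (map g [0..<n])) g \<notin> I"
    if legal: "legal_run G \<phi> (\<lambda>n. \<rho> (map g [0..<n])) g" for g
  proof
    let ?a = "\<lambda>n. \<rho> (map g [0..<n])"
    assume "run_union \<phi> ?a g \<in> I"
    then obtain y where y: "y \<in> D" "run_union \<phi> ?a g \<subseteq> F y" using cover by blast
    define c where "c = (\<lambda>j. digits_code (map y [0..<j]))"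
    have c: "strict_mono c" "c 0 = 0"
      using strict_mono_digits_code_prefix[of y] by (simp_all add: c_def digits_code_def)
    have "?a (c j) = \<sigma> (map (\<lambda>i. (g (c i), y i)) [0..<j])" for j
      by (simp add: \<rho>_def c_def simulated_history_prefix)
    then have "(\<lambda>j. ((?a \<circ> c) j, (g \<circ> c) j, y j)) \<notin> unfolded_payoff G \<phi> D F"
      using \<sigma>[of "\<lambda>i. (g (c i), y i)"] by simp
    moreover have "run_union \<phi> (?a \<circ> c) (g \<circ> c) \<subseteq> F y"
      using run_union_subsequence y(2) by (rule order_trans)
    ultimately show False
      using legal_run_subsequence[OF legal c] y(1) unfolding mem_unfolded_payoff_iff by blast
  qed
  then show ?thesis unfolding I_wins_def using \<sigma>_mem \<rho>_def by (intro exI[of _ \<rho>]) simp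
qed

lemma unfolded_second_player_wins_imp_II_wins:
  assumes wins: "second_player_wins I (unfolded_payoff G \<phi> D F)"
    and small: "\<And>y A. y \<in> D \<Longrightarrow> A \<subseteq> F y \<Longrightarrow> A \<in> I"
  shows "II_wins G \<phi> I"
proof -
  obtain \<tau> where \<tau>: "\<And>a. (\<forall>n. a n \<in> I) \<Longrightarrow>
      (\<lambda>n. (a n, \<tau> (map a [0..<Suc n]))) \<in> unfolded_payoff G \<phi> D F"
    using wins unfolding second_player_wins_def by blast
  have "legal_run G \<phi> a (\<lambda>n. fst (\<tau> (map a [0..<Suc n]))) \<and>
      run_union \<phi> a (\<lambda>n. fst (\<tau> (map a [0..<Suc n]))) \<in> I" if "\<forall>n. a n \<in> I" for a
  proof -
    define g y where "g = (\<lambda>n. fst (\<tau> (map a [0..<Suc n])))"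
      and "y = (\<lambda>n. snd (\<tau> (map a [0..<Suc n])))"
    have "(\<lambda>n. (a n, g n, y n)) \<in> unfolded_payoff G \<phi> D F"
      using \<tau>[OF that] by (simp add: g_def y_def del: upt_Suc)
    then have "legal_run G \<phi> a g \<and> run_union \<phi> a g \<in> I"
      using small unfolding mem_unfolded_payoff_iff by blast
    then show ?thesis unfolding g_def .
  qed
  then show ?thesis unfolding II_wins_def by (intro exI[of _ "fst \<circ> \<tau>"]) simp
qed

theorem closed_coded_ideal_determined:
  fixes D :: "(nat \<Rightarrow> nat) set"
  assumes "closedin sequence_topology D"
    and "\<And>x. closedin sequence_topology {y \<in> D. x \<in> F y}"
    and I: "I = {A. \<exists>y\<in>D. A \<subseteq> F y}"
  shows "DC_game_determined G \<phi> I"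
  using closed_game_determined[OF closedin_unfolded_payoff[OF assms(1,2)]]
proof
  assume "first_player_wins I (unfolded_payoff G \<phi> D F)"
  then have "I_wins G \<phi> I" by (rule unfolded_first_player_wins_imp_I_wins) (simp add: I)
  then show ?thesis by (simp add: DC_game_determined_def)
next
  assume "second_player_wins I (unfolded_payoff G \<phi> D F)"
  then have "II_wins G \<phi> I" by (rule unfolded_second_player_wins_imp_II_wins) (auto simp: I)
  then show ?thesis by (simp add: DC_game_determined_def)
qed

section \<open>Projections of closed sets along the Baire space\<close>

definition souslin :: "'a::topological_space set \<Rightarrow> bool" where
  "souslin S \<longleftrightarrow> (\<exists>C :: ('a \<times> (nat \<Rightarrow> nat)) set. closed C \<and> S = {z. \<exists>w. (z, w) \<in> C})"

definition slice :: "nat \<Rightarrow> (nat \<Rightarrow> 'a) \<Rightarrow> nat \<Rightarrow> 'a" where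
  "slice k w = (\<lambda>i. w (prod_encode (k, i)))"

definition of_slices :: "(nat \<Rightarrow> nat \<Rightarrow> 'a) \<Rightarrow> nat \<Rightarrow> 'a" where
  "of_slices W = (\<lambda>m. case prod_decode m of (k, i) \<Rightarrow> W k i)"

lemma slice_of_slices [simp]: "slice k (of_slices W) = W k"
  by (simp add: slice_def of_slices_def)

lemma continuous_on_slice: "continuous_on UNIV (slice k :: (nat \<Rightarrow> 'a::topological_space) \<Rightarrow> _)"
  unfolding slice_def by (intro continuous_intros continuous_on_product_coordinates)

lemma closed_Collect_coordinate_neq: "closed {w :: nat \<Rightarrow> nat. w i \<noteq> n}"
proof -
  have "closed ((\<lambda>w :: nat \<Rightarrow> nat. w i) -` (- {n}))"
    by (intro closed_vimage continuous_on_product_coordinates) (simp add: closed_def open_discrete)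
  then show ?thesis by (simp add: vimage_def)
qed

lemma closed_vimage_apsnd:
  assumes "closed C" and "continuous_on UNIV h"
  shows "closed (apsnd h -` C)"
proof (rule closed_vimage[OF assms(1)])
  have apsnd: "apsnd h = (\<lambda>p. (fst p, h (snd p)))" by auto
  show "continuous_on UNIV (apsnd h)"
    unfolding apsnd
    by (intro continuous_on_Pair continuous_on_fst continuous_on_id
        continuous_on_compose2[OF assms(2) continuous_on_snd]) simp
qed

lemma souslin_closed: "closed S \<Longrightarrow> souslin S"
  unfolding souslin_def by (intro exI[of _ "S \<times> UNIV"]) (simp add: closed_Times)

lemma souslin_UN:
  fixes S :: "nat \<Rightarrow> 'a::topological_space set"
  assumes "\<And>n. souslin (S n)"
  shows "souslin (\<Union>n. S n)"
proof -
  obtain C :: "nat \<Rightarrow> ('a \<times> (nat \<Rightarrow> nat)) set"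
    where C: "\<And>n. closed (C n)" "\<And>n. S n = {z. \<exists>w. (z, w) \<in> C n}"
    using assms unfolding souslin_def by metis
  define D where "D = (\<Inter>n. UNIV \<times> {w. w 0 \<noteq> n} \<union> apsnd (\<lambda>w i. w (Suc i)) -` C n)"
  have "closed D"
    unfolding D_def
    by (intro closed_INT ballI closed_Un closed_Times closed_UNIV closed_Collect_coordinate_neq
        closed_vimage_apsnd C continuous_on_coordinatewise_then_product
        continuous_on_product_coordinates)
  moreover have "(\<exists>n w. (z, w) \<in> C n) \<longleftrightarrow> (\<exists>w. (z, w) \<in> D)" for z
  proof
    assume "\<exists>n w. (z, w) \<in> C n"
    then obtain n w where "(z, w) \<in> C n" by blast
    then have "(z, case_nat n w) \<in> D" by (auto simp: D_def)
    then show "\<exists>w. (z, w) \<in> D" by blast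
  qed (auto simp: D_def)
  then have "(\<Union>n. S n) = {z. \<exists>w. (z, w) \<in> D}" by (auto simp: C(2))
  ultimately show ?thesis unfolding souslin_def by blast
qed

lemma souslin_INT:
  fixes S :: "nat \<Rightarrow> 'a::topological_space set"
  assumes "\<And>n. souslin (S n)"
  shows "souslin (\<Inter>n. S n)"
proof -
  obtain C :: "nat \<Rightarrow> ('a \<times> (nat \<Rightarrow> nat)) set"
    where C: "\<And>n. closed (C n)" "\<And>n. S n = {z. \<exists>w. (z, w) \<in> C n}"
    using assms unfolding souslin_def by metis
  define D where "D = (\<Inter>n. apsnd (slice n) -` C n)"
  have "closed D"
    unfolding D_def by (intro closed_INT ballI closed_vimage_apsnd C continuous_on_slice)
  moreover have "(\<forall>n. \<exists>w. (z, w) \<in> C n) \<longleftrightarrow> (\<exists>w. (z, w) \<in> D)" for z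
  proof
    assume "\<forall>n. \<exists>w. (z, w) \<in> C n"
    then obtain W where "\<forall>n. (z, W n) \<in> C n" by metis
    then have "(z, of_slices W) \<in> D" by (simp add: D_def)
    then show "\<exists>w. (z, w) \<in> D" by blast
  qed (auto simp: D_def)
  then have "(\<Inter>n. S n) = {z. \<exists>w. (z, w) \<in> D}" by (auto simp: C(2))
  ultimately show ?thesis unfolding souslin_def by blast
qed

lemma souslin_open:
  fixes U :: "'a::topological_space set"
  assumes "metrizable_space (euclidean :: 'a topology)" and "open U"
  shows "souslin U"
proof -
  have "fsigma_in euclidean U"
    using assms by (intro open_imp_fsigma_in) simp_all
  then obtain C where "\<And>n :: nat. closed (C n)" "\<Union> (range C) = U"
    unfolding fsigma_in_ascending by auto
  then show ?thesis using souslin_UN[of C] souslin_closed by auto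
qed

lemma souslin_borel:
  fixes B :: "'a::topological_space set"
  assumes "metrizable_space (euclidean :: 'a topology)" and "B \<in> sets borel"
  shows "souslin B"
proof -
  have "B \<in> sigma_sets UNIV {S. open S}" using assms(2) by (simp add: sets_borel)
  then have "souslin B \<and> souslin (- B)"
  proof induction
    case (Basic a)
    then show ?case using assms(1) by (simp add: souslin_open souslin_closed closed_Compl)
  next
    case Empty
    then show ?case by (simp add: souslin_closed)
  next
    case (Compl a)
    then show ?case by (simp add: Compl_eq_Diff_UNIV[symmetric])
  next
    case (Union a)
    then show ?case by (simp add: souslin_UN souslin_INT)
  qed
  then show ?thesis ..
qed

lemma souslin_fst_image:
  fixes S :: "('a::topological_space \<times> (nat \<Rightarrow> nat)) set"
  assumes "souslin S"
  shows "souslin (fst ` S)"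
proof -
  obtain C where C: "closed C" "S = {p. \<exists>w :: nat \<Rightarrow> nat. (p, w) \<in> C}"
    using assms unfolding souslin_def by blast
  define D where "D = (\<lambda>p. ((fst p, slice 0 (snd p)), slice 1 (snd p))) -` C"
  have "closed D"
    unfolding D_def
    by (intro closed_vimage C(1) continuous_on_Pair continuous_on_fst continuous_on_id
        continuous_on_compose2[OF continuous_on_slice continuous_on_snd]) auto
  moreover have "(\<exists>v w. ((z, v), w) \<in> C) \<longleftrightarrow> (\<exists>w. (z, w) \<in> D)" for z
  proof
    assume "\<exists>v w. ((z, v), w) \<in> C"
    then obtain v w where "((z, v), w) \<in> C" by blast
    then have "(z, of_slices (case_nat v (\<lambda>_. w))) \<in> D" by (simp add: D_def)
    then show "\<exists>w. (z, w) \<in> D" by blast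
  qed (auto simp: D_def)
  moreover have "fst ` S = {z. \<exists>v w. ((z, v), w) \<in> C}" unfolding C(2) by force
  ultimately show ?thesis unfolding souslin_def by auto
qed

lemma metrizable_space_baire: "metrizable_space (euclidean :: (nat \<Rightarrow> nat) topology)"
  by (simp add: metrizable_space_product_topology sequence_topology_def flip: sequence_topology_nat)

lemma souslin_range_borel:
  fixes h :: "(nat \<Rightarrow> nat) \<Rightarrow> 'a::second_countable_topology"
  assumes metrizable: "metrizable_space (euclidean :: 'a topology)"
    and [measurable]: "h \<in> borel_measurable borel"
  shows "souslin (range h)"
proof -
  let ?graph = "(\<lambda>p. (fst p, h (snd p))) -` range (\<lambda>x. (x, x))"
  have diagonal: "closed (range (\<lambda>x :: 'a. (x, x)))"
    using Hausdorff_space_closedin_diagonal[of "euclidean :: 'a topology"]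
      metrizable_imp_Hausdorff_space[OF metrizable]
    by simp
  have [measurable]: "fst \<in> borel_measurable (borel :: ('a \<times> (nat \<Rightarrow> nat)) measure)"
    "snd \<in> borel_measurable (borel :: ('a \<times> (nat \<Rightarrow> nat)) measure)"
    by (intro borel_measurable_continuous_onI continuous_intros)+
  have "(\<lambda>p :: 'a \<times> (nat \<Rightarrow> nat). (fst p, h (snd p))) \<in> borel_measurable borel"
    by measurable
  then have "?graph \<in> sets borel"
    using diagonal by (rule measurable_sets_borel[OF _ borel_closed])
  moreover have "metrizable_space (euclidean :: ('a \<times> (nat \<Rightarrow> nat)) topology)"
    using metrizable metrizable_space_baire
    by (simp add: metrizable_space_prod_topology flip: prod_topology_euclidean)
  ultimately have "souslin (fst ` ?graph)"
    by (intro souslin_fst_image souslin_borel)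
  moreover have "?graph = range (\<lambda>z. (h z, z))" by auto
  ultimately show ?thesis by (simp add: image_image)
qed

lemma souslin_eq_slice_image_closed:
  fixes S :: "(nat \<Rightarrow> nat) set"
  assumes "souslin S"
  obtains D :: "(nat \<Rightarrow> nat) set" where "closed D" and "slice 0 ` D = S"
proof -
  obtain C where C: "closed C" "S = {z. \<exists>w :: nat \<Rightarrow> nat. (z, w) \<in> C}"
    using assms unfolding souslin_def by blast
  define D where "D = (\<lambda>y. (slice 0 y, slice 1 y)) -` C"
  have "closed D"
    unfolding D_def by (intro closed_vimage C(1) continuous_on_Pair continuous_on_slice)
  moreover have "slice 0 ` D = S"
  proof (intro equalityI subsetI)
    fix z assume "z \<in> S"
    then obtain w where "(z, w) \<in> C" by (auto simp: C(2))
    then have "of_slices (case_nat z (\<lambda>_. w)) \<in> D" by (simp add: D_def)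
    then show "z \<in> slice 0 ` D" by (rule image_eqI[rotated]) simp
  qed (auto simp: D_def C(2))
  ultimately show ?thesis by (rule that)
qed

section \<open>Analytic families of closed sets\<close>

lemma separable_metrizable_imp_second_countable:
  assumes "separable_space T" and "metrizable_space T"
  shows "second_countable T"
proof -
  obtain M d where "Metric_space M d" and T: "T = Metric_space.mtopology M d"
    using assms(2) by (auto simp: metrizable_space_def)
  interpret Metric_space M d by fact
  obtain C where C: "countable C" "C \<subseteq> M" "mtopology closure_of C = M"
    using assms(1) by (auto simp: separable_space_def T)
  define \<B> where "\<B> = (\<lambda>(c, n :: nat). mball c (inverse (real (Suc n)))) ` (C \<times> UNIV)"
  have "countable \<B>" "\<forall>V\<in>\<B>. openin T V" using C(1) by (auto simp: \<B>_def T)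
  moreover have "\<exists>V\<in>\<B>. x \<in> V \<and> V \<subseteq> U" if U: "openin T U" "x \<in> U" for U x
  proof -
    obtain r where r: "r > 0" "mball x r \<subseteq> U" and x: "x \<in> M"
      using U unfolding T openin_mtopology by blast
    obtain n where n: "inverse (real (Suc n)) < r / 2"
      using reals_Archimedean[of "r / 2"] r(1) by auto
    let ?s = "inverse (real (Suc n))"
    have "x \<in> mtopology closure_of C" using x C(3) by simp
    moreover have "?s > 0" by simp
    ultimately obtain c where c: "c \<in> C" "c \<in> mball x ?s" unfolding metric_closure_of by blast
    have "mball c ?s \<subseteq> mball x r"
      using c n by (intro mball_subset) (auto simp: commute)
    moreover have "x \<in> mball c ?s" using c by (simp add: commute in_mball)
    ultimately show ?thesis using r(2) c(1) unfolding \<B>_def by blast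
  qed
  ultimately show ?thesis unfolding second_countable_def by blast
qed

definition base_sequence :: "'a topology \<Rightarrow> (nat \<Rightarrow> 'a set) \<Rightarrow> bool" where
  "base_sequence T Q \<longleftrightarrow>
     (\<forall>k. openin T (Q k)) \<and> (\<forall>U x. openin T U \<and> x \<in> U \<longrightarrow> (\<exists>k. x \<in> Q k \<and> Q k \<subseteq> U))"

lemma second_countable_imp_base_sequence:
  assumes "second_countable T"
  obtains Q where "base_sequence T Q"
proof -
  obtain \<B> where \<B>: "countable \<B>" "\<forall>V\<in>\<B>. openin T V"
    "\<forall>U x. openin T U \<and> x \<in> U \<longrightarrow> (\<exists>V\<in>\<B>. x \<in> V \<and> V \<subseteq> U)"
    using assms unfolding second_countable_def by blast
  have range: "range (from_nat_into (insert {} \<B>)) = insert {} \<B>"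
    using \<B>(1) by (intro range_from_nat_into) auto
  have "base_sequence T (from_nat_into (insert {} \<B>))"
    unfolding base_sequence_def
  proof (intro conjI allI impI)
    show "openin T (from_nat_into (insert {} \<B>) k)" for k
      using range \<B>(2) by (metis insertE openin_empty rangeI)
    show "\<exists>k. x \<in> from_nat_into (insert {} \<B>) k \<and> from_nat_into (insert {} \<B>) k \<subseteq> U"
      if "openin T U \<and> x \<in> U" for U x
      using range \<B>(3) that by (metis (no_types, lifting) insertI2 rangeE)
  qed
  then show ?thesis by (rule that)
qed

definition closed_of_pattern :: "'a topology \<Rightarrow> (nat \<Rightarrow> 'a set) \<Rightarrow> (nat \<Rightarrow> nat) \<Rightarrow> 'a set" where
  "closed_of_pattern T Q p = topspace T - (\<Union>k\<in>{k. p k = 0}. Q k)"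

definition hit_pattern :: "(nat \<Rightarrow> 'a set) \<Rightarrow> 'a set \<Rightarrow> nat \<Rightarrow> nat" where
  "hit_pattern Q F = (\<lambda>k. of_bool (F \<inter> Q k \<noteq> {}))"

lemma closed_of_hit_pattern:
  assumes "base_sequence T Q" and "closedin T F"
  shows "closed_of_pattern T Q (hit_pattern Q F) = F"
proof (intro equalityI subsetI)
  fix x assume x: "x \<in> closed_of_pattern T Q (hit_pattern Q F)"
  show "x \<in> F"
  proof (rule ccontr)
    assume "x \<notin> F"
    moreover have "openin T (topspace T - F)" using assms(2) by blast
    moreover have "x \<in> topspace T" using x by (simp add: closed_of_pattern_def)
    ultimately obtain k where "x \<in> Q k" "Q k \<subseteq> topspace T - F"
      using assms(1) unfolding base_sequence_def by blast
    then show False using x by (auto simp: closed_of_pattern_def hit_pattern_def)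
  qed
next
  fix x assume "x \<in> F"
  then show "x \<in> closed_of_pattern T Q (hit_pattern Q F)"
    using closedin_subset[OF assms(2)] by (auto simp: closed_of_pattern_def hit_pattern_def)
qed

lemma space_effros_borel: "space (effros_borel T) = {F. closedin T F}"
  unfolding effros_borel_def by (rule space_measure_of) auto

lemma measurable_hit_pattern:
  assumes "base_sequence T Q"
  shows "hit_pattern Q \<in> effros_borel T \<rightarrow>\<^sub>M borel"
proof (rule measurable_coordinatewise_then_product)
  fix k
  have "{F \<in> space (effros_borel T). F \<inter> Q k \<noteq> {}} = {F. closedin T F \<and> F \<inter> Q k \<noteq> {}}"
    by (auto simp: space_effros_borel)
  also have "\<dots> \<in> sets (effros_borel T)"
    using assms unfolding effros_borel_def base_sequence_def by (subst sets_measure_of) auto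
  finally have [measurable]: "Measurable.pred (effros_borel T) (\<lambda>F. F \<inter> Q k \<noteq> {})"
    by (simp add: pred_def)
  show "(\<lambda>F. hit_pattern Q F k) \<in> borel_measurable (effros_borel T)"
    unfolding hit_pattern_def by measurable
qed

lemma analytic_in_effros_borel_souslin_patterns:
  assumes Q: "base_sequence T Q" and analytic: "analytic_in (effros_borel T) \<F>"
  obtains S where "souslin S" and "closed_of_pattern T Q ` S = \<F>"
proof (cases "\<F> = {}")
  case True
  then show ?thesis using that[of "{}"] by (simp add: souslin_closed)
next
  case False
  then obtain f where f: "f \<in> (borel :: (nat \<Rightarrow> nat) measure) \<rightarrow>\<^sub>M effros_borel T" "range f = \<F>"
    using analytic unfolding analytic_in_def by blast
  have closed: "closedin T F" if "F \<in> \<F>" for F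
    using analytic that by (auto simp: analytic_in_def space_effros_borel)
  show ?thesis
  proof (rule that)
    show "souslin (range (\<lambda>z. hit_pattern Q (f z)))"
      by (intro souslin_range_borel metrizable_space_baire measurable_compose[OF f(1)]
          measurable_hit_pattern Q)
    show "closed_of_pattern T Q ` range (\<lambda>z. hit_pattern Q (f z)) = \<F>"
      using closed_of_hit_pattern[OF Q closed] f(2) by (auto simp: image_image image_iff)
  qed
qed

lemma closed_Collect_mem_closed_of_pattern:
  "closed {y :: nat \<Rightarrow> nat. x \<in> closed_of_pattern T Q (slice j y)}"
proof (cases "x \<in> topspace T")
  case True
  then have "{y. x \<in> closed_of_pattern T Q (slice j y)} =
      (\<Inter>k\<in>{k. x \<in> Q k}. {y. y (prod_encode (j, k)) \<noteq> 0})"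
    by (force simp: closed_of_pattern_def slice_def)
  also have "closed \<dots>" by (intro closed_INT ballI closed_Collect_coordinate_neq)
  finally show ?thesis .
qed (simp add: closed_of_pattern_def)

theorem analytic_closed_generated_determined:
  assumes "second_countable T" and analytic: "analytic_in (effros_borel T) \<F>"
    and I: "I = {A. \<exists>B\<in>\<F>. A \<subseteq> B}"
  shows "DC_game_determined G \<phi> I"
proof -
  obtain Q where "base_sequence T Q"
    using assms(1) by (rule second_countable_imp_base_sequence)
  then obtain S where "souslin S" and S: "closed_of_pattern T Q ` S = \<F>"
    using analytic by (rule analytic_in_effros_borel_souslin_patterns)
  obtain D where D: "closed D" "slice 0 ` D = S"
    using \<open>souslin S\<close> by (rule souslin_eq_slice_image_closed)
  show ?thesis
  proof (rule closed_coded_ideal_determined)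
    show "closedin sequence_topology D" using D(1) by (simp add: sequence_topology_nat)
    show "closedin sequence_topology {y \<in> D. x \<in> closed_of_pattern T Q (slice 0 y)}" for x
      using closed_Int[OF D(1) closed_Collect_mem_closed_of_pattern[of x T Q 0]]
      by (simp add: sequence_topology_nat Collect_conj_eq)
    show "I = {A. \<exists>y\<in>D. A \<subseteq> closed_of_pattern T Q (slice 0 y)}"
      unfolding I S[symmetric] D(2)[symmetric] by blast
  qed
qed

theorem mainTheorem7:
  fixes G :: "('g, 'b) monoid_scheme" and \<phi> :: "'g \<Rightarrow> 'x \<Rightarrow> 'x"
    and X :: "'x set" and I :: "'x set set"
  assumes "dynamical_ideal G \<phi> X I"
  shows "(\<forall>(atom :: 'x \<Rightarrow> 'v) mem act.
            atom_structure G \<phi> X atom mem act \<longrightarrow>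
            W_contains_DC_counterexample G \<phi> X I atom mem act \<longrightarrow>
            I_wins G \<phi> I)
       \<and> (\<forall>T \<F>. Polish_topology T \<longrightarrow> topspace T = X \<longrightarrow>
            \<F> \<subseteq> {F. closedin T F} \<longrightarrow>
            analytic_in (effros_borel T) \<F> \<longrightarrow>
            I = {A. \<exists>B\<in>\<F>. A \<subseteq> B} \<longrightarrow>
            DC_game_determined G \<phi> I)"
proof (intro conjI allI impI)
  show "I_wins G \<phi> I"
    if "atom_structure G \<phi> X atom mem act" "W_contains_DC_counterexample G \<phi> X I atom mem act"
    for atom :: "'x \<Rightarrow> 'v" and mem act
    using assms that by (rule DC_counterexample_imp_I_wins)
next
  fix T :: "'x topology" and \<F>
  assume "Polish_topology T"
  then have "second_countable T"
    unfolding Polish_topology_def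
    by (intro separable_metrizable_imp_second_countable completely_metrizable_imp_metrizable_space)
      simp_all
  moreover assume "analytic_in (effros_borel T) \<F>" "I = {A. \<exists>B\<in>\<F>. A \<subseteq> B}"
  ultimately show "DC_game_determined G \<phi> I" by (rule analytic_closed_generated_determined)
qed

end
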